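(* Let $x^1,\dots,x^n\in\mathbb{R}^m$ and $d_{ij}=\|x^i-x^j\|_2^2$. Let $\{\Gamma_1,\Gamma_2\}$ be a partition of $[n]$ with, without loss of generality, $|\Gamma_1|\le|\Gamma_2|$. Define $$r_1:=\frac{2|\Gamma_1|}{|\Gamma_1|+|\Gamma_2|},\qquad r_2:=\frac{2|\Gamma_2|}{|\Gamma_1|+|\Gamma_2|},$$ and $$\eta:=\frac{r_2}{2}\Bigg(\Big(1-\frac{r_1}{r_2}\Big)\max_{k\in\Gamma_1}d^{\rm in}_k+\Big(1-\frac{r_2}{r_1}\Big)\min_{k\in\Gamma_2}d^{\rm in}_k+\frac{r_1}{r_2}\cdot\frac{1}{|\Gamma_1|}\sum_{k\in\Gamma_1}d^{\rm in}_k+\frac{r_2}{r_1}\cdot\frac{1}{|\Gamma_2|}\sum_{k\in\Gamma_2}d^{\rm in}_k\Bigg).$$ Suppose that $$\frac{1}{|\Gamma_2|}\sum_{k\in\Gamma_2}\min\{r_2d_{ik}+d^{\rm in}_j,\ r_2d_{jk}+d^{\rm in}_i\}-d_{ij}\ \ge\ \eta,\qquad\forall\, i<j\in\Gamma_1,$$ and $$\frac{1}{|\Gamma_1|}\sum_{k\in\Gamma_1}\min\{r_1d_{ik}+d^{\rm in}_j,\ r_1d_{jk}+d^{\rm in}_i\}-d_{ij}\ \ge\ \frac{r_1}{r_2}\eta,\qquad\forall\, i<j\in\Gamma_2.$$ Then an optimal solution of the linear program (LP2) is given by the partition matrix $$\bar X=\frac{1}{|\Gamma_1|}\mathbf{1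}_{\Gamma_1}\mathbf{1}_{\Gamma_1}^T+\frac{1}{|\Gamma_2|}\mathbf{1}_{\Gamma_2}\mathbf{1}_{\Gamma_2}^T.$$
   Context: $[n]:=\{1,\dots,n\}$. A partition $\{\Gamma_1,\Gamma_2\}$ of $[n]$ consists of two non-empty disjoint subsets with union $[n]$. $\mathbf{1}_{\Gamma}\in\mathbb{R}^n$ is the indicator vector of $\Gamma\subseteq[n]$. For $i\in\Gamma_l$, $l\in\{1,2\}$: $d^{\rm in}_i:=\frac{1}{|\Gamma_l|}\sum_{j\in\Gamma_l}d_{ij}$ (the sum includes $j=i$, with $d_{ii}=0$). (LP2) is the linear program in the entries of a symmetric matrix $X\in\mathbb{R}^{n\times n}$ ($X_{ij}=X_{ji}$): minimize $\sum_{i,j\in[n]}d_{ij}X_{ij}$ subject to $\mathrm{Tr}(X)=2$; $\sum_{j=1}^nX_{ij}=1$ for all $i\in[n]$; $X_{ij}+X_{ik}\le X_{ii}+X_{jk}$ for all pairwise distinct $i,j,k\in[n]$ with $j<k$; $X_{ij}\ge0$ for all $1\le i<j\le n$. *)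

theory Defs
  imports "HOL-Analysis.Analysis"
begin

text \<open>
  The index set \<open>[n]\<close> is a finite linearly ordered type \<open>'n\<close> with \<open>n = CARD('n)\<close>.
\<close>

text \<open>
  The two parts are required to be disjoint; \<open>partition_on UNIV {G1, G2}\<close>
  would also admit \<open>G1 = G2 = UNIV\<close>.
\<close>
definition bipartition :: "'n set \<Rightarrow> 'n set \<Rightarrow> bool" where
  "bipartition G1 G2 \<longleftrightarrow> G1 \<noteq> {} \<and> G2 \<noteq> {} \<and> G1 \<inter> G2 = {} \<and> G1 \<union> G2 = UNIV"

text \<open>Only meaningful for \<open>i \<in> G\<close>, where \<open>G\<close> is the part containing \<open>i\<close>.\<close>
definition d_in :: "('n \<Rightarrow> 'n \<Rightarrow> real) \<Rightarrow> 'n set \<Rightarrow> 'n \<Rightarrow> real" where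
  "d_in d G i = 1 / real (card G) * (\<Sum>j\<in>G. d i j)"

definition ind_vec :: "'n::finite set \<Rightarrow> real ^ 'n" where
  "ind_vec G = (\<chi> i. indicator G i)"

definition outer_prod :: "real ^ 'n \<Rightarrow> real ^ 'n \<Rightarrow> real ^ 'n ^ 'n" where
  "outer_prod u v = (\<chi> i j. u $ i * v $ j)"

definition partition_matrix :: "'n::finite set \<Rightarrow> 'n set \<Rightarrow> real ^ 'n ^ 'n" where
  "partition_matrix G1 G2 =
     (1 / real (card G1)) *\<^sub>R outer_prod (ind_vec G1) (ind_vec G1) +
     (1 / real (card G2)) *\<^sub>R outer_prod (ind_vec G2) (ind_vec G2)"

definition LP2_feasible :: "real ^ 'n::{finite,linorder} ^ 'n::{finite,linorder} \<Rightarrow> bool" where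
  "LP2_feasible X \<longleftrightarrow>
     transpose X = X \<and>
     trace X = 2 \<and>
     (\<forall>i. (\<Sum>j\<in>UNIV. X $ i $ j) = 1) \<and>
     (\<forall>i j k. i \<noteq> j \<and> i \<noteq> k \<and> j < k \<longrightarrow> X $ i $ j + X $ i $ k \<le> X $ i $ i + X $ j $ k) \<and>
     (\<forall>i j. i < j \<longrightarrow> X $ i $ j \<ge> 0)"

definition LP2_objective :: "('n::finite \<Rightarrow> 'n \<Rightarrow> real) \<Rightarrow> real ^ 'n ^ 'n \<Rightarrow> real" where
  "LP2_objective d X = (\<Sum>i\<in>UNIV. \<Sum>j\<in>UNIV. d i j * X $ i $ j)"

definition LP2_optimal :: "('n::{finite,linorder} \<Rightarrow> 'n \<Rightarrow> real) \<Rightarrow> real ^ 'n::{finite,linorder} ^ 'n::{finite,linorder} \<Rightarrow> bool" where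
  "LP2_optimal d X \<longleftrightarrow> is_arg_min (LP2_objective d) LP2_feasible X"

end

theory Submission
  imports Defs
begin

text \<open>
  The partition matrix is feasible and its cost is the sum of all average within-cluster distances
  \<open>d_in\<close>, so the content of the theorem is that no feasible \<open>X\<close> costs less. This is weak LP
  duality, but the dual certificate is never written out; instead, the cost of \<open>X\<close> inside each
  cluster is bounded from below, and the two bounds are added.

  Complementary slackness at the partition matrix suggests using only the triangle inequalities
  whose apex \<open>i\<close> and one further index \<open>j\<close> lie in one cluster \<open>G\<close> and whose last index \<open>k\<close> lies in the
  other cluster \<open>H\<close>. With \<open>Q i j = X i i + X j j - 2 * X i j\<close> and \<open>y i k = X i i - 2 * X i k\<close>, the two
  inequalities obtained by swapping \<open>i\<close> and \<open>j\<close> say exactly \<open>\<bar>y i k - y j k\<bar> \<le> Q i j\<close>. Hence, for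
  every \<open>f\<close>, the product \<open>(f i k - f j k) * (y i k - y j k)\<close> is at most \<open>\<bar>f i k - f j k\<bar> * Q i j\<close>.
  The choice \<open>f i k = \<rho> * d i k - d_in i\<close> is dictated by the minima in the hypotheses: writing
  \<open>\<bar>u - v\<bar> = u + v - 2 * min u v\<close> turns these hypotheses into an upper bound for the average over \<open>k\<close>
  of \<open>\<bar>f i k - f j k\<bar>\<close> of the form \<open>\<mu> i + \<mu> j - 2 * d i j\<close>
  (\<open>min_condition_bounds_deviation\<close>). Summing over \<open>i\<close>, \<open>j\<close>, \<open>k\<close> therefore puts \<open>d i j * X i j\<close> on one
  side, while everything on the other side collapses to diagonal terms and terms \<open>X i k\<close> across the
  clusters (\<open>within_cluster_cost_bound\<close>).

  Adding the bounds for both clusters, the diagonal terms carry the same factor for both, because the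
  thresholds \<open>\<eta>\<close> and \<open>r1 / r2 * \<eta>\<close> have the same product with the respective cluster size, so they
  reduce to the trace of \<open>X\<close>. In the coefficient of a cross term \<open>X i k\<close> all distances cancel
  because \<open>r1 + r2 = 2\<close> and \<open>r1 / n1 = r2 / n2\<close>; what remains is
  \<open>\<eta> * (1 + n1 / n2) - (1 - n1 / n2) * d_in i - (1 - n2 / n1) * d_in k\<close> minus a constant, where \<open>n1\<close> and
  \<open>n2\<close> are the cluster sizes. As \<open>n1 \<le> n2\<close>, the worst case is the maximal \<open>d_in i\<close> and the minimal
  \<open>d_in k\<close>, and \<open>\<eta>\<close> is the value for which the coefficient vanishes there. So the cross terms only
  add to the cost.
\<close>

section \<open>A lower bound for the cost inside one cluster\<close>

lemma sum_products_of_differences: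
  fixes f g :: "'a \<Rightarrow> real"
  shows "(\<Sum>i\<in>G. \<Sum>j\<in>G. (f i - f j) * (g i - g j))
    = 2 * real (card G) * (\<Sum>i\<in>G. f i * g i) - 2 * (\<Sum>i\<in>G. f i) * (\<Sum>i\<in>G. g i)"
proof -
  have "(\<Sum>i\<in>G. \<Sum>j\<in>G. (f i - f j) * (g i - g j))
      = (\<Sum>i\<in>G. \<Sum>j\<in>G. f i * g i) + (\<Sum>i\<in>G. \<Sum>j\<in>G. f j * g j)
        - (\<Sum>i\<in>G. \<Sum>j\<in>G. f i * g j) - (\<Sum>i\<in>G. \<Sum>j\<in>G. g i * f j)"
    by (simp add: algebra_simps sum.distrib sum_subtractf)
  then show ?thesis
    by (simp add: sum_distrib_left[symmetric] sum_distrib_right[symmetric])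
qed

text \<open>
  The separation condition rewritten in terms of absolute values: the terms under the minimum differ
  by exactly \<open>(\<rho> * d i k - a i) - (\<rho> * d j k - a j)\<close>, and \<open>\<bar>u - v\<bar> = u + v - 2 * min u v\<close>.
  The two brackets on the right are the values that serve as multipliers of the row-sum constraints.
\<close>
lemma min_condition_bounds_deviation:
  fixes d :: "'a \<Rightarrow> 'a \<Rightarrow> real" and a :: "'a \<Rightarrow> real"
  assumes "finite H" "H \<noteq> {}"
    and cond: "1 / real (card H) * (\<Sum>k\<in>H. min (\<rho> * d i k + a j) (\<rho> * d j k + a i)) - d i j \<ge> \<theta>"
  shows "(\<Sum>k\<in>H. \<bar>(\<rho> * d i k - a i) - (\<rho> * d j k - a j)\<bar>) / real (card H)
    \<le> (\<rho> / real (card H) * (\<Sum>k\<in>H. d i k) + a i - \<theta>)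
      + (\<rho> / real (card H) * (\<Sum>k\<in>H. d j k) + a j - \<theta>) - 2 * d i j"
proof -
  define h where "h = real (card H)"
  have h: "h > 0" using assms by (simp add: h_def card_gt_0_iff)
  have "(\<Sum>k\<in>H. \<bar>(\<rho> * d i k - a i) - (\<rho> * d j k - a j)\<bar>)
      = (\<Sum>k\<in>H. \<rho> * d i k + \<rho> * d j k + (a i + a j)
          - 2 * min (\<rho> * d i k + a j) (\<rho> * d j k + a i))"
    by (intro sum.cong) (auto simp: min_def)
  also have "\<dots> = \<rho> * (\<Sum>k\<in>H. d i k) + \<rho> * (\<Sum>k\<in>H. d j k) + h * (a i + a j)
      - 2 * (\<Sum>k\<in>H. min (\<rho> * d i k + a j) (\<rho> * d j k + a i))"
    by (simp add: sum.distrib sum_subtractf sum_distrib_left h_def)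
  finally have "(\<Sum>k\<in>H. \<bar>(\<rho> * d i k - a i) - (\<rho> * d j k - a j)\<bar>) / h
      = \<rho> / h * (\<Sum>k\<in>H. d i k) + \<rho> / h * (\<Sum>k\<in>H. d j k) + (a i + a j)
        - 2 * (1 / h * (\<Sum>k\<in>H. min (\<rho> * d i k + a j) (\<rho> * d j k + a i)))"
    using h by (simp add: add_divide_distrib diff_divide_distrib)
  then show ?thesis
    using cond unfolding h_def[symmetric] by linarith
qed

text \<open>
  Here \<open>H\<close> is the other cluster and \<open>a\<close> is \<open>d_in\<close> of \<open>G\<close>. The right-hand side contains \<open>X\<close> only through
  its diagonal and through entries across the clusters: the row-sum constraint is used to trade
  the remaining entries inside \<open>G\<close> for cross entries. In terms of duality, \<open>\<mu>\<close> are the multipliers of the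
  row sums and the bracket is the part of the reduced cost of \<open>X i k\<close> that this cluster contributes.
\<close>
lemma within_cluster_cost_bound:
  fixes d X :: "'a \<Rightarrow> 'a \<Rightarrow> real" and a \<mu> :: "'a \<Rightarrow> real" and \<rho> \<theta> :: real
  assumes fin: "finite G" "finite H" and ne: "H \<noteq> {}"
    and dsym: "\<And>i j. d i j = d j i"
    and Xsym: "\<And>i j. X i j = X j i"
    and avg: "\<And>i. i \<in> G \<Longrightarrow> (\<Sum>j\<in>G. d i j) = real (card G) * a i"
    and \<mu>: "\<And>i. i \<in> G \<Longrightarrow> \<mu> i = \<rho> / real (card H) * (\<Sum>k\<in>H. d i k) + a i - \<theta>"
    and cond: "\<And>i j. \<lbrakk>i \<in> G; j \<in> G; i \<noteq> j\<rbrakk> \<Longrightarrow>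
      1 / real (card H) * (\<Sum>k\<in>H. min (\<rho> * d i k + a j) (\<rho> * d j k + a i)) - d i j \<ge> \<theta>"
    and tri: "\<And>i j k. \<lbrakk>i \<in> G; j \<in> G; k \<in> H\<rbrakk> \<Longrightarrow> X i j + X i k \<le> X i i + X j k"
    and row: "\<And>i. i \<in> G \<Longrightarrow> (\<Sum>j\<in>G. X i j) + (\<Sum>k\<in>H. X i k) = 1"
  shows "(\<Sum>i\<in>G. \<Sum>j\<in>G. d i j * X i j) \<ge>
    (\<Sum>i\<in>G. \<mu> i) - (\<Sum>i\<in>G. \<mu> i - a i) * (\<Sum>i\<in>G. X i i)
    + (\<Sum>i\<in>G. \<Sum>k\<in>H. X i k *
        ((\<Sum>j\<in>G. \<rho> * d j k - a j) / real (card H)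
          - real (card G) / real (card H) * (\<rho> * d i k - a i) - \<mu> i))"
proof -
  define g h where "g = real (card G)" and "h = real (card H)"
  have h: "h > 0" using fin ne by (simp add: h_def card_gt_0_iff)
  define f where "f i k = \<rho> * d i k - a i" for i k
  define y where "y i k = X i i - 2 * X i k" for i k
  define Q where "Q i j = X i i + X j j - 2 * X i j" for i j
  define F where "F k = (\<Sum>i\<in>G. f i k)" for k
  define M where "M = (\<Sum>i\<in>G. \<mu> i)"
  define D where "D = (\<Sum>i\<in>G. a i)"
  define t where "t = (\<Sum>i\<in>G. X i i)"
  define W where "W = (\<Sum>i\<in>G. \<Sum>j\<in>G. d i j * X i j)"
  define A where "A = (\<Sum>i\<in>G. \<mu> i * X i i)"
  define B where "B = (\<Sum>i\<in>G. a i * X i i)"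
  define C where "C = (\<Sum>i\<in>G. \<mu> i * (\<Sum>j\<in>G. X i j))"
  define E where "E = (\<Sum>i\<in>G. \<Sum>k\<in>H. f i k * X i k)"
  define K where "K = (\<Sum>i\<in>G. \<Sum>k\<in>H. F k * X i k)"

  have pair: "(\<Sum>k\<in>H. (f i k - f j k) * (y i k - y j k)) \<le> h * ((\<mu> i + \<mu> j - 2 * d i j) * Q i j)"
    if ij: "i \<in> G" "j \<in> G" for i j
  proof (cases "i = j")
    case True
    then show ?thesis by (simp add: Q_def)
  next
    case False
    have "\<bar>y i k - y j k\<bar> \<le> Q i j" if "k \<in> H" for k
      using tri[OF ij that] tri[OF ij(2,1) that] Xsym[of i j]
      unfolding y_def Q_def by linarith
    then have "\<bar>f i k - f j k\<bar> * \<bar>y i k - y j k\<bar> \<le> \<bar>f i k - f j k\<bar> * Q i j" if "k \<in> H" for k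
      using that by (intro mult_left_mono) auto
    then have "(f i k - f j k) * (y i k - y j k) \<le> \<bar>f i k - f j k\<bar> * Q i j" if "k \<in> H" for k
      using that abs_ge_self[of "(f i k - f j k) * (y i k - y j k)"]
      unfolding abs_mult by (meson order_trans)
    then have "(\<Sum>k\<in>H. (f i k - f j k) * (y i k - y j k)) \<le> (\<Sum>k\<in>H. \<bar>f i k - f j k\<bar> * Q i j)"
      by (intro sum_mono)
    also have "\<dots> = (\<Sum>k\<in>H. \<bar>f i k - f j k\<bar>) * Q i j"
      by (simp add: sum_distrib_right)
    also have "\<dots> \<le> h * (\<mu> i + \<mu> j - 2 * d i j) * Q i j"
    proof (rule mult_right_mono)
      show "(\<Sum>k\<in>H. \<bar>f i k - f j k\<bar>) \<le> h * (\<mu> i + \<mu> j - 2 * d i j)"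
        using min_condition_bounds_deviation[OF fin(2) ne cond[OF ij False]] h
        unfolding f_def \<mu>[OF ij(1)] \<mu>[OF ij(2)] h_def[symmetric]
        by (simp add: pos_divide_le_eq mult.commute)
      obtain k where "k \<in> H" using ne by blast
      then show "Q i j \<ge> 0"
        using tri[OF ij \<open>k \<in> H\<close>] tri[OF ij(2,1) \<open>k \<in> H\<close>] Xsym[of i j] unfolding Q_def by linarith
    qed
    finally show ?thesis by (simp add: mult.assoc)
  qed
  \<comment> \<open>The terms with \<open>i = j\<close> vanish, so the sums may run over all of \<open>G\<close>; the rest of the
    proof expands both sides of this inequality.\<close>
  have key: "(\<Sum>i\<in>G. \<Sum>j\<in>G. \<Sum>k\<in>H. (f i k - f j k) * (y i k - y j k))
      \<le> h * (\<Sum>i\<in>G. \<Sum>j\<in>G. (\<mu> i + \<mu> j - 2 * d i j) * Q i j)"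
    unfolding sum_distrib_left by (intro sum_mono pair)

  have fsum: "(\<Sum>k\<in>H. f i k) = h * (\<mu> i + \<theta> - 2 * a i)" if "i \<in> G" for i
    using h unfolding \<mu>[OF that] f_def h_def
    by (simp add: sum_subtractf sum_distrib_left field_simps)
  have "(\<Sum>k\<in>H. \<Sum>i\<in>G. f i k * y i k)
      = (\<Sum>i\<in>G. (\<Sum>k\<in>H. f i k) * X i i) - 2 * E"
    by (subst sum.swap) (simp add: y_def E_def algebra_simps sum_subtractf sum_distrib_left)
  also have "(\<Sum>i\<in>G. (\<Sum>k\<in>H. f i k) * X i i) = h * (A + \<theta> * t - 2 * B)"
    by (simp add: fsum A_def B_def t_def algebra_simps sum.distrib sum_subtractf sum_distrib_left)
  finally have fy: "(\<Sum>k\<in>H. \<Sum>i\<in>G. f i k * y i k) = h * (A + \<theta> * t - 2 * B) - 2 * E" .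
  have Fsum: "(\<Sum>k\<in>H. F k) = h * (M + g * \<theta> - 2 * D)"
    unfolding F_def by (subst sum.swap)
      (simp add: fsum M_def D_def g_def sum.distrib sum_subtractf flip: sum_distrib_left)
  have ysum: "(\<Sum>i\<in>G. y i k) = t - 2 * (\<Sum>i\<in>G. X i k)" for k
    by (simp add: y_def t_def sum_subtractf sum_distrib_left)
  have "(\<Sum>k\<in>H. F k * (\<Sum>i\<in>G. y i k)) = (\<Sum>k\<in>H. F k) * t - 2 * (\<Sum>k\<in>H. \<Sum>i\<in>G. F k * X i k)"
    by (simp add: ysum right_diff_distrib sum_subtractf sum_distrib_left sum_distrib_right mult_ac)
  then have Fy: "(\<Sum>k\<in>H. F k * (\<Sum>i\<in>G. y i k)) = h * (M + g * \<theta> - 2 * D) * t - 2 * K"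
    unfolding Fsum K_def by (subst (asm) sum.swap)
  have "(\<Sum>i\<in>G. \<Sum>j\<in>G. \<Sum>k\<in>H. (f i k - f j k) * (y i k - y j k))
      = (\<Sum>k\<in>H. \<Sum>i\<in>G. \<Sum>j\<in>G. (f i k - f j k) * (y i k - y j k))"
    by (subst sum.swap[of _ H], intro sum.cong refl sum.swap)
  also have "\<dots> = 2 * g * (\<Sum>k\<in>H. \<Sum>i\<in>G. f i k * y i k) - 2 * (\<Sum>k\<in>H. F k * (\<Sum>i\<in>G. y i k))"
    unfolding sum_products_of_differences g_def F_def
    by (simp add: sum_subtractf mult.assoc flip: sum_distrib_left)
  finally have lhs: "(\<Sum>i\<in>G. \<Sum>j\<in>G. \<Sum>k\<in>H. (f i k - f j k) * (y i k - y j k))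
      = 2 * g * (h * (A + \<theta> * t - 2 * B) - 2 * E) - 2 * (h * (M + g * \<theta> - 2 * D) * t - 2 * K)"
    unfolding fy Fy .

  have s1: "(\<Sum>i\<in>G. \<Sum>j\<in>G. \<mu> i * X i i) = g * A"
    by (simp add: A_def g_def sum_distrib_left)
  have s2: "(\<Sum>i\<in>G. \<Sum>j\<in>G. \<mu> i * X j j) = M * t"
    by (simp add: M_def t_def sum_product)
  have s3: "(\<Sum>i\<in>G. \<Sum>j\<in>G. \<mu> i * X i j) = C"
    by (simp add: C_def sum_distrib_left)
  have s4: "(\<Sum>i\<in>G. \<Sum>j\<in>G. d i j * X i i) = g * B"
    by (simp add: B_def g_def avg sum_distrib_left flip: sum_distrib_right) (simp add: mult.assoc)
  have "(\<Sum>i\<in>G. \<Sum>j\<in>G. (\<mu> i + \<mu> j - 2 * d i j) * Q i j)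
      = 2 * (\<Sum>i\<in>G. \<Sum>j\<in>G. (\<mu> i - d i j) * Q i j)"
  proof -
    have "(\<Sum>i\<in>G. \<Sum>j\<in>G. (\<mu> j - d i j) * Q i j) = (\<Sum>i\<in>G. \<Sum>j\<in>G. (\<mu> i - d i j) * Q i j)"
      by (subst sum.swap, intro sum.cong refl) (simp add: Q_def dsym Xsym)
    moreover have "(\<Sum>i\<in>G. \<Sum>j\<in>G. (\<mu> i + \<mu> j - 2 * d i j) * Q i j)
      = (\<Sum>i\<in>G. \<Sum>j\<in>G. (\<mu> i - d i j) * Q i j) + (\<Sum>i\<in>G. \<Sum>j\<in>G. (\<mu> j - d i j) * Q i j)"
      unfolding sum.distrib[symmetric] by (intro sum.cong refl) (simp add: algebra_simps)
    ultimately show ?thesis by simp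
  qed
  also have "(\<Sum>i\<in>G. \<Sum>j\<in>G. (\<mu> i - d i j) * Q i j)
      = g * A + M * t - 2 * C - 2 * g * B + 2 * W"
  proof -
    have s5: "(\<Sum>i\<in>G. \<Sum>j\<in>G. d i j * X j j) = g * B"
      unfolding s4[symmetric] by (subst sum.swap, intro sum.cong refl) (simp add: dsym)
    have "(\<Sum>i\<in>G. \<Sum>j\<in>G. (\<mu> i - d i j) * Q i j)
      = (\<Sum>i\<in>G. \<Sum>j\<in>G. \<mu> i * X i i) + (\<Sum>i\<in>G. \<Sum>j\<in>G. \<mu> i * X j j)
        - 2 * (\<Sum>i\<in>G. \<Sum>j\<in>G. \<mu> i * X i j) - (\<Sum>i\<in>G. \<Sum>j\<in>G. d i j * X i i)
        - (\<Sum>i\<in>G. \<Sum>j\<in>G. d i j * X j j) + 2 * (\<Sum>i\<in>G. \<Sum>j\<in>G. d i j * X i j)"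
      unfolding sum_distrib_left sum.distrib[symmetric] sum_subtractf[symmetric]
      by (intro sum.cong refl) (simp add: Q_def algebra_simps)
    then show ?thesis unfolding s1 s2 s3 s4 s5 W_def by simp
  qed
  finally have rhs: "(\<Sum>i\<in>G. \<Sum>j\<in>G. (\<mu> i + \<mu> j - 2 * d i j) * Q i j)
      = 2 * (g * A + M * t - 2 * C - 2 * g * B + 2 * W)" .

  have "h * W \<ge> h * C - h * (M - D) * t - g * E + K"
    using key unfolding lhs rhs by (simp add: algebra_simps)
  then have W: "W \<ge> C - (M - D) * t - g / h * E + K / h"
    using h by (simp add: field_simps)
  have C: "C = M - (\<Sum>i\<in>G. \<mu> i * (\<Sum>k\<in>H. X i k))"
  proof -
    have "C = (\<Sum>i\<in>G. \<mu> i * (1 - (\<Sum>k\<in>H. X i k)))"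
      unfolding C_def using row by (intro sum.cong refl) (simp add: algebra_simps flip: row)
    then show ?thesis by (simp add: M_def algebra_simps sum_subtractf)
  qed
  have "(\<Sum>i\<in>G. \<Sum>k\<in>H. X i k * (F k / h - g / h * f i k - \<mu> i))
      = K / h - g / h * E - (\<Sum>i\<in>G. \<mu> i * (\<Sum>k\<in>H. X i k))"
    by (simp add: K_def E_def algebra_simps sum.distrib sum_subtractf sum_distrib_left sum_divide_distrib)
  then show ?thesis
    using W C unfolding W_def M_def D_def t_def F_def f_def g_def h_def
    by (simp add: sum_subtractf)
qed

section \<open>The partition matrix\<close>

lemma partition_matrix_entry:
  "partition_matrix G1 G2 $ i $ j =
    (if i \<in> G1 \<and> j \<in> G1 then 1 / real (card G1) else 0)
    + (if i \<in> G2 \<and> j \<in> G2 then 1 / real (card G2) else 0)"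
  by (simp add: partition_matrix_def outer_prod_def ind_vec_def indicator_def)

lemma sum_bipartition:
  fixes f :: "'n::finite \<Rightarrow> real"
  assumes "bipartition G1 G2"
  shows "(\<Sum>i\<in>UNIV. f i) = (\<Sum>i\<in>G1. f i) + (\<Sum>i\<in>G2. f i)"
  using assms unfolding bipartition_def by (metis finite sum.union_disjoint)

lemma bipartition_not_mem:
  assumes "bipartition G1 G2"
  shows "i \<in> G1 \<Longrightarrow> i \<notin> G2" "i \<in> G2 \<Longrightarrow> i \<notin> G1"
  using assms by (auto simp: bipartition_def)

lemma partition_matrix_feasible:
  assumes part: "bipartition G1 G2"
  shows "LP2_feasible (partition_matrix G1 G2)"
proof -
  note nm = bipartition_not_mem[OF part]
  have c: "G1 \<noteq> {}" "G2 \<noteq> {}"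
    using part by (auto simp: bipartition_def)
  have mem: "i \<in> G1 \<or> i \<in> G2" for i using part by (auto simp: bipartition_def)
  show ?thesis
    unfolding LP2_feasible_def
  proof (intro conjI allI impI)
    show "transpose (partition_matrix G1 G2) = partition_matrix G1 G2"
      by (auto simp: transpose_def vec_eq_iff partition_matrix_entry)
    show "trace (partition_matrix G1 G2) = 2"
      using c by (simp add: trace_def sum_bipartition[OF part] partition_matrix_entry nm)
    show "(\<Sum>j\<in>UNIV. partition_matrix G1 G2 $ i $ j) = 1" for i
      using c mem[of i] by (auto simp: sum_bipartition[OF part] partition_matrix_entry nm)
    show "partition_matrix G1 G2 $ i $ j + partition_matrix G1 G2 $ i $ k
        \<le> partition_matrix G1 G2 $ i $ i + partition_matrix G1 G2 $ j $ k" for i j k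
      using mem[of i] mem[of j] mem[of k] by (auto simp: partition_matrix_entry nm)
    show "partition_matrix G1 G2 $ i $ j \<ge> 0" for i j
      by (simp add: partition_matrix_entry)
  qed
qed

lemma partition_matrix_objective:
  assumes part: "bipartition G1 G2"
  shows "LP2_objective d (partition_matrix G1 G2)
    = (\<Sum>i\<in>G1. d_in d G1 i) + (\<Sum>i\<in>G2. d_in d G2 i)"
  by (simp add: LP2_objective_def sum_bipartition[OF part] partition_matrix_entry
      bipartition_not_mem[OF part] d_in_def sum_distrib_left)

section \<open>Optimality of the partition matrix\<close>

theorem proposition1:
  fixes x :: "'n::{finite,linorder} \<Rightarrow> real ^ 'm"
    and d :: "'n \<Rightarrow> 'n \<Rightarrow> real"
    and G1 G2 :: "'n set"
    and r1 r2 \<eta> :: real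
  assumes d_eq: "\<And>i j. d i j = (norm (x i - x j))\<^sup>2"
    and part: "bipartition G1 G2"
    and card_le: "card G1 \<le> card G2"
    and r1_eq: "r1 = 2 * real (card G1) / (real (card G1) + real (card G2))"
    and r2_eq: "r2 = 2 * real (card G2) / (real (card G1) + real (card G2))"
    and eta_eq: "\<eta> = r2 / 2 *
        ((1 - r1 / r2) * Max (d_in d G1 ` G1)
         + (1 - r2 / r1) * Min (d_in d G2 ` G2)
         + r1 / r2 * (1 / real (card G1)) * (\<Sum>k\<in>G1. d_in d G1 k)
         + r2 / r1 * (1 / real (card G2)) * (\<Sum>k\<in>G2. d_in d G2 k))"
    and cond1: "\<And>i j. \<lbrakk>i \<in> G1; j \<in> G1; i < j\<rbrakk> \<Longrightarrow>
        1 / real (card G2) *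
          (\<Sum>k\<in>G2. min (r2 * d i k + d_in d G1 j) (r2 * d j k + d_in d G1 i)) - d i j \<ge> \<eta>"
    and cond2: "\<And>i j. \<lbrakk>i \<in> G2; j \<in> G2; i < j\<rbrakk> \<Longrightarrow>
        1 / real (card G1) *
          (\<Sum>k\<in>G1. min (r1 * d i k + d_in d G2 j) (r1 * d j k + d_in d G2 i)) - d i j
        \<ge> r1 / r2 * \<eta>"
  shows "LP2_optimal d (partition_matrix G1 G2)"
proof -
  define n1 n2 where "n1 = real (card G1)" and "n2 = real (card G2)"
  have ne: "G1 \<noteq> {}" "G2 \<noteq> {}" using part by (auto simp: bipartition_def)
  have n: "n1 > 0" "n2 > 0" "n1 \<le> n2"
    using ne card_le by (auto simp: n1_def n2_def card_gt_0_iff)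
  have dsym: "d i j = d j i" for i j by (simp add: d_eq norm_minus_commute)
  define a where "a = d_in d G1"
  define b where "b = d_in d G2"
  have r: "r1 = 2 * n1 / (n1 + n2)" "r2 = 2 * n2 / (n1 + n2)"
    using r1_eq r2_eq by (simp_all add: n1_def n2_def)
  have ratio: "r1 / r2 = n1 / n2" "r2 / r1 = n2 / n1" using n add_pos_pos[OF n(1,2)] by (simp_all add: r)
  have rn: "r2 / n2 = 2 / (n1 + n2)" "r1 / n1 = 2 / (n1 + n2)" using n by (simp_all add: r)
  define S1 where "S1 = (\<Sum>i\<in>G1. a i)"
  define S2 where "S2 = (\<Sum>i\<in>G2. b i)"
  define \<theta> where "\<theta> = r1 / r2 * \<eta>"
  define T where "T i = (\<Sum>k\<in>G2. d i k)" for i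
  define U where "U k = (\<Sum>i\<in>G1. d k i)" for k
  define \<mu> where "\<mu> i = r2 / n2 * T i + a i - \<eta>" for i
  define \<nu> where "\<nu> k = r1 / n1 * U k + b k - \<theta>" for k
  define \<omega> where "\<omega> = 2 / (n1 + n2) * (\<Sum>i\<in>G1. T i) - n1 * \<eta>"
  \<comment> \<open>The factor of the diagonal of \<open>X\<close> comes out as the same \<open>\<omega>\<close> for both clusters: the
    distance parts agree because \<open>r1 / n1 = r2 / n2\<close>, the rest because \<open>n2 * \<theta> = n1 * \<eta>\<close>.\<close>
  have TU: "(\<Sum>k\<in>G2. U k) = (\<Sum>i\<in>G1. T i)"
    unfolding T_def U_def by (subst sum.swap) (simp add: dsym)
  have \<omega>1: "(\<Sum>i\<in>G1. \<mu> i - a i) = \<omega>"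
    by (simp add: \<mu>_def \<omega>_def rn sum_subtractf n1_def flip: sum_distrib_left sum_divide_distrib)
  have \<omega>2: "(\<Sum>k\<in>G2. \<nu> k - b k) = \<omega>"
    using n by (simp add: \<nu>_def \<omega>_def rn sum_subtractf n1_def[symmetric] n2_def[symmetric] \<theta>_def ratio TU
        flip: sum_distrib_left sum_divide_distrib)

  \<comment> \<open>The prefactor \<open>r2 / 2\<close> in \<open>\<eta>\<close> is the inverse of \<open>1 + n1 / n2\<close>, the factor with which the
    two thresholds enter a cross coefficient together.\<close>
  have \<eta>: "\<eta> * (1 + n1 / n2) = (1 - n1 / n2) * Max (a ` G1) + (1 - n2 / n1) * Min (b ` G2)
      + S1 / n2 + S2 / n1"
  proof -
    have "1 + n1 / n2 = (n1 + n2) / n2" using n by (simp add: field_simps)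
    then have "r2 / 2 * (1 + n1 / n2) = 1" using n add_pos_pos[OF n(1,2)] by (simp add: r)
    moreover have "\<eta> = r2 / 2 * ((1 - n1 / n2) * Max (a ` G1) + (1 - n2 / n1) * Min (b ` G2)
      + S1 / n2 + S2 / n1)" (is "_ = _ * ?Z")
      using n unfolding eta_eq ratio a_def[symmetric] b_def[symmetric] n1_def[symmetric] n2_def[symmetric]
        S1_def[symmetric] S2_def[symmetric] by simp
    then have "\<eta> * (1 + n1 / n2) = r2 / 2 * (1 + n1 / n2) * ?Z"
      by (simp only: mult_ac)
    ultimately show ?thesis by simp
  qed

  \<comment> \<open>The total coefficient of \<open>X i k\<close> across the clusters is nonnegative; the objective itself
    contributes \<open>2 * d i k\<close> because \<open>X\<close> is symmetric.\<close>
  have \<sigma>: "2 * d i k + ((\<Sum>j\<in>G1. r2 * d j k - a j) / n2 - n1 / n2 * (r2 * d i k - a i) - \<mu> i)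
      + ((\<Sum>l\<in>G2. r1 * d l i - b l) / n1 - n2 / n1 * (r1 * d k i - b k) - \<nu> k) \<ge> 0"
    if ik: "i \<in> G1" "k \<in> G2" for i k
  proof -
    have s1: "(\<Sum>j\<in>G1. r2 * d j k - a j) / n2 = r2 / n2 * U k - S1 / n2"
      by (simp add: U_def S1_def dsym[of _ k] sum_subtractf diff_divide_distrib flip: sum_distrib_left)
    have s2: "(\<Sum>l\<in>G2. r1 * d l i - b l) / n1 = r1 / n1 * T i - S2 / n1"
      by (simp add: T_def S2_def dsym[of _ i] sum_subtractf diff_divide_distrib flip: sum_distrib_left)
    have s3: "n1 / n2 * (r2 * d i k - a i) = r1 * d i k - n1 / n2 * a i"
      "n2 / n1 * (r1 * d k i - b k) = r2 * d i k - n2 / n1 * b k"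
      using n by (simp_all add: r field_simps dsym[of k i])
    have "r1 + r2 = 2 * (n1 + n2) / (n1 + n2)"
      by (simp add: r add_divide_distrib distrib_left)
    then have "r1 + r2 = 2"
      using add_pos_pos[OF n(1,2)] by (subst (asm) nonzero_mult_div_cancel_right) auto
    then have r12: "r1 * d i k + r2 * d i k = 2 * d i k"
      by (simp flip: distrib_right)
    have "(1 - n1 / n2) * a i \<le> (1 - n1 / n2) * Max (a ` G1)"
      using n ik by (intro mult_left_mono) auto
    moreover have "(1 - n2 / n1) * b k \<le> (1 - n2 / n1) * Min (b ` G2)"
      \<comment> \<open>The factor is nonpositive since \<open>n1 \<le> n2\<close>, hence the minimum.\<close>
      using n ik by (intro mult_left_mono_neg) auto
    ultimately have "(1 - n1 / n2) * a i + (1 - n2 / n1) * b k + S1 / n2 + S2 / n1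
        \<le> \<eta> * (1 + n1 / n2)" unfolding \<eta> by linarith
    then show ?thesis
      unfolding s1 s2 s3 \<mu>_def \<nu>_def \<theta>_def rn ratio using r12 by (simp add: algebra_simps)
  qed

  have lower: "S1 + S2 \<le> LP2_objective d X" if feas: "LP2_feasible X" for X
  proof -
    define Y where "Y i j = X $ i $ j" for i j
    have Ysym: "Y i j = Y j i" for i j
    proof -
      have "transpose X $ i $ j = X $ i $ j" using feas by (simp add: LP2_feasible_def)
      then show ?thesis by (simp add: transpose_def Y_def)
    qed
    have row: "(\<Sum>j\<in>G1. Y i j) + (\<Sum>j\<in>G2. Y i j) = 1" for i
      using feas by (simp add: LP2_feasible_def Y_def flip: sum_bipartition[OF part])
    have tr: "(\<Sum>i\<in>G1. Y i i) + (\<Sum>i\<in>G2. Y i i) = 2"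
      using feas by (simp add: LP2_feasible_def trace_def Y_def flip: sum_bipartition[OF part])
    have nonneg: "Y i j \<ge> 0" if "i \<noteq> j" for i j
    proof -
      have pos: "Y p q \<ge> 0" if "p < q" for p q
        using feas that unfolding LP2_feasible_def Y_def by blast
      show ?thesis
        using \<open>i \<noteq> j\<close> pos[of i j] pos[of j i] Ysym[of i j] by (cases i j rule: linorder_cases) auto
    qed
    have tri: "Y i j + Y i k \<le> Y i i + Y j k" if "i \<noteq> k" "j \<noteq> k" for i j k
    proof (cases "i = j")
      case False
      have t: "Y i p + Y i q \<le> Y i i + Y p q" if "i \<noteq> p" "i \<noteq> q" "p < q" for p q
        using feas that unfolding LP2_feasible_def Y_def by blast
      show ?thesis
        using t[of j k] t[of k j] Ysym[of j k] that False by (cases j k rule: linorder_cases) auto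
    qed simp
    have disj: "i \<noteq> k" if "i \<in> G1" "k \<in> G2" for i k
      using part that by (auto simp: bipartition_def)
    have avg: "(\<Sum>j\<in>G1. d i j) = real (card G1) * a i" "(\<Sum>j\<in>G2. d i j) = real (card G2) * b i" for i
      using n by (simp_all add: a_def b_def d_in_def n1_def n2_def)
    have c1: "1 / real (card G2) * (\<Sum>k\<in>G2. min (r2 * d i k + a j) (r2 * d j k + a i)) - d i j \<ge> \<eta>"
      if "i \<in> G1" "j \<in> G1" "i \<noteq> j" for i j
      using cond1[of i j] cond1[of j i] that unfolding a_def
      by (cases i j rule: linorder_cases) (auto simp: min.commute dsym[of j i])
    have c2: "1 / real (card G1) * (\<Sum>k\<in>G1. min (r1 * d i k + b j) (r1 * d j k + b i)) - d i j \<ge> \<theta>"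
      if "i \<in> G2" "j \<in> G2" "i \<noteq> j" for i j
      using cond2[of i j] cond2[of j i] that unfolding b_def \<theta>_def
      by (cases i j rule: linorder_cases) (auto simp: min.commute dsym[of j i])
    define c where "c i k = (\<Sum>j\<in>G1. r2 * d j k - a j) / n2 - n1 / n2 * (r2 * d i k - a i) - \<mu> i" for i k
    define e where "e i k = (\<Sum>l\<in>G2. r1 * d l i - b l) / n1 - n2 / n1 * (r1 * d k i - b k) - \<nu> k" for i k
    have b1: "(\<Sum>i\<in>G1. \<Sum>j\<in>G1. d i j * Y i j) \<ge>
        (\<Sum>i\<in>G1. \<mu> i) - \<omega> * (\<Sum>i\<in>G1. Y i i) + (\<Sum>i\<in>G1. \<Sum>k\<in>G2. Y i k * c i k)"
      unfolding \<omega>1[symmetric] c_def n1_def n2_def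
      by (rule within_cluster_cost_bound[where \<theta> = \<eta>, OF _ _ ne(2) dsym Ysym avg(1) _ c1 _ row])
        (auto simp: \<mu>_def T_def n2_def dest: disj intro!: tri)
    have "(\<Sum>i\<in>G2. \<Sum>j\<in>G2. d i j * Y i j) \<ge>
        (\<Sum>k\<in>G2. \<nu> k) - \<omega> * (\<Sum>i\<in>G2. Y i i) + (\<Sum>k\<in>G2. \<Sum>i\<in>G1. Y k i * e i k)"
      unfolding \<omega>2[symmetric] e_def n1_def n2_def
      by (rule within_cluster_cost_bound[where \<theta> = \<theta>, OF _ _ ne(1) dsym Ysym avg(2) _ c2])
        (use row in \<open>auto simp: \<nu>_def U_def n1_def add.commute dest: disj intro!: tri\<close>)
    moreover have "(\<Sum>k\<in>G2. \<Sum>i\<in>G1. Y k i * e i k) = (\<Sum>i\<in>G1. \<Sum>k\<in>G2. Y i k * e i k)"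
      by (subst sum.swap) (simp add: Ysym)
    ultimately have b2: "(\<Sum>i\<in>G2. \<Sum>j\<in>G2. d i j * Y i j) \<ge>
        (\<Sum>k\<in>G2. \<nu> k) - \<omega> * (\<Sum>i\<in>G2. Y i i) + (\<Sum>i\<in>G1. \<Sum>k\<in>G2. Y i k * e i k)"
      by simp
    have obj: "LP2_objective d X = (\<Sum>i\<in>G1. \<Sum>j\<in>G1. d i j * Y i j) + (\<Sum>i\<in>G2. \<Sum>j\<in>G2. d i j * Y i j)
        + 2 * (\<Sum>i\<in>G1. \<Sum>k\<in>G2. d i k * Y i k)"
    proof -
      have "(\<Sum>i\<in>G2. \<Sum>j\<in>G1. d i j * Y i j) = (\<Sum>i\<in>G1. \<Sum>k\<in>G2. d i k * Y i k)"
        by (subst sum.swap) (simp add: Ysym dsym)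
      then show ?thesis
        by (simp add: LP2_objective_def sum_bipartition[OF part] sum.distrib flip: Y_def)
    qed
    have "(\<Sum>i\<in>G1. \<Sum>k\<in>G2. Y i k * (2 * d i k + c i k + e i k)) \<ge> 0"
      using \<sigma> nonneg disj unfolding c_def e_def by (intro sum_nonneg mult_nonneg_nonneg) auto
    also have "(\<Sum>i\<in>G1. \<Sum>k\<in>G2. Y i k * (2 * d i k + c i k + e i k))
        = 2 * (\<Sum>i\<in>G1. \<Sum>k\<in>G2. d i k * Y i k)
          + (\<Sum>i\<in>G1. \<Sum>k\<in>G2. Y i k * c i k) + (\<Sum>i\<in>G1. \<Sum>k\<in>G2. Y i k * e i k)"
      by (simp add: algebra_simps sum.distrib sum_distrib_left)
    finally have "LP2_objective d X \<ge> (\<Sum>i\<in>G1. \<mu> i) + (\<Sum>k\<in>G2. \<nu> k)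
        - \<omega> * ((\<Sum>i\<in>G1. Y i i) + (\<Sum>i\<in>G2. Y i i))"
      using b1 b2 unfolding obj by (simp add: algebra_simps)
    then show ?thesis
      using \<omega>1 \<omega>2 unfolding tr by (simp add: sum_subtractf S1_def S2_def)
  qed
  show ?thesis
    unfolding LP2_optimal_def is_arg_min_def
    using partition_matrix_feasible[OF part] partition_matrix_objective[OF part, of d] lower
    by (auto simp: S1_def S2_def a_def b_def not_less)
qed

end
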